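(* Let $G$ be a connected amply regular graph with parameters $(n,d,\alpha,\beta)$ (with $n=\infty$ allowed), which is neither complete nor empty. If $\beta\ge\max\{3,\alpha\}$, then the diameter of $G$ satisfies $$\mathrm{diam}(G)\le\left\lfloor\frac{2d}{2+\max\left\{\frac{\alpha}{2},\left\lceil\frac{\beta-\alpha}{\beta-1}\alpha\right\rceil\right\}}\right\rfloor.$$
   Context: All graphs are simple and undirected. An amply regular graph with parameters $(n,d,\alpha,\beta)$ is a $d$-regular graph ($d$ finite) with $n$ vertices, $n=\infty$ being allowed, such that any two adjacent vertices have exactly $\alpha$ common neighbors and any two vertices at distance $2$ have exactly $\beta$ common neighbors. The diameter is taken with respect to the combinatorial (shortest path) distance. *)

theory Defs
  imports Complex_Main "HOL-Library.Extended_Nat" "Graph_Theory.Graph_Theory"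
begin

text \<open>
  A simple undirected graph, finite or infinite, is a \<^typ>\<open>'a pair_pre_digraph\<close> whose arc set is
  a symmetric, irreflexive relation on its vertex set; this is exactly the locale
  \<^locale>\<open>pair_bidirected_digraph\<close>. An edge between u and v is present as both arcs (u,v) and (v,u).
\<close>

definition neighbours :: "'a pair_pre_digraph \<Rightarrow> 'a \<Rightarrow> 'a set" where
  "neighbours G v = {w. (v, w) \<in> parcs G}"

definition common_neighbours :: "'a pair_pre_digraph \<Rightarrow> 'a \<Rightarrow> 'a \<Rightarrow> 'a set" where
  "common_neighbours G u v = neighbours G u \<inter> neighbours G v"

definition graph_order :: "'a pair_pre_digraph \<Rightarrow> enat" where
  "graph_order G = (if finite (pverts G) then enat (card (pverts G)) else \<infinity>)"

text \<open>The infimum of the empty set of walks is \<open>\<infinity>\<close>.\<close>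

definition graph_dist :: "'a pair_pre_digraph \<Rightarrow> 'a \<Rightarrow> 'a \<Rightarrow> enat" where
  "graph_dist G u v = (INF p \<in> {p. pre_digraph.awalk (with_proj G) u p v}. enat (length p))"

definition diameter :: "'a pair_pre_digraph \<Rightarrow> enat" where
  "diameter G = (SUP u \<in> pverts G. SUP v \<in> pverts G. graph_dist G u v)"

definition complete_graph :: "'a pair_pre_digraph \<Rightarrow> bool" where
  "complete_graph G \<longleftrightarrow> (\<forall>u \<in> pverts G. \<forall>v \<in> pverts G. u \<noteq> v \<longrightarrow> (u, v) \<in> parcs G)"

text \<open>Empty means edgeless; the vertex set may be nonempty.\<close>

definition empty_graph :: "'a pair_pre_digraph \<Rightarrow> bool" where
  "empty_graph G \<longleftrightarrow> parcs G = {}"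

text \<open>
  Finiteness of the neighbourhoods is required explicitly, because \<^const>\<open>card\<close> is 0 on infinite
  sets. It also makes all sets of common neighbours finite.
\<close>

locale amply_regular_graph = pair_bidirected_digraph G
  for G :: "'a pair_pre_digraph" +
  fixes n :: enat and d \<alpha> \<beta> :: nat
  assumes order: "graph_order G = n"
    and finite_neighbours: "v \<in> pverts G \<Longrightarrow> finite (neighbours G v)"
    and regular: "v \<in> pverts G \<Longrightarrow> card (neighbours G v) = d"
    and adjacent: "(u, v) \<in> parcs G \<Longrightarrow> card (common_neighbours G u v) = \<alpha>"
    and distance_two: "\<lbrakk>u \<in> pverts G; v \<in> pverts G; graph_dist G u v = 2\<rbrakk>
      \<Longrightarrow> card (common_neighbours G u v) = \<beta>"

end

theory Submission
  imports "HOL-Analysis.Convex" Defs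
begin

text \<open>
  The two terms of the maximum come from two notions of discrete Ricci curvature, each followed by
  its Bonnet-Myers argument.

  Lin-Lu-Yau curvature: let \<open>xy\<close> be an edge and let \<open>f\<close> be 1-Lipschitz with \<open>f y = f x + 1\<close>. The edges
  between \<open>N x - {y}\<close> and \<open>N y - {x}\<close> form a bipartite graph in which a vertex has degree \<open>\<alpha> - 1\<close> or
  \<open>\<beta> - 1\<close>, according to whether it is a common neighbour of \<open>x\<close> and \<open>y\<close>. Summing the increments of \<open>f\<close>
  along these edges shows that the Laplacian of \<open>f\<close> drops from \<open>x\<close> to \<open>y\<close> by at least
  \<open>2 + \<alpha> (\<beta> - \<alpha>) / (\<beta> - 1)\<close>, hence, being an integer, by the rounded up value. For the distance
  function of a vertex the Laplacian takes values in \<open>[-d, d]\<close>, which bounds the length of a geodesic.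

  Bakry-Emery curvature: every vertex satisfies the curvature-dimension inequality
  \<open>CD(K, \<infinity>)\<close> with \<open>K = 2 + \<alpha> / 2\<close>. After eliminating the values of \<open>f\<close> on the second sphere around the
  vertex, this amounts to \<open>4 \<theta> (\<theta> - \<alpha>) + (2 \<beta> - 4) d \<ge> 0\<close> for the eigenvalues \<open>\<theta>\<close> of the local graph,
  and the left side is at least \<open>(2 \<beta> - 4) d - \<alpha>\<^sup>2 \<ge> 0\<close>. A small Euler step of the heat flow
  contracts the supremum of \<open>|\<nabla>f|\<^sup>2\<close> by the factor \<open>1 - 2 K \<epsilon> + O(\<epsilon>\<^sup>2)\<close> and moves \<open>f\<close> by at most
  \<open>\<epsilon> \<surd>d |\<nabla>f|\<close>; comparing the two effects bounds the oscillation of \<open>f\<close> between two vertices.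
\<close>

text \<open>The ring is left open: the transport bound relies on integrality, while the heat flow
  needs real values.\<close>

definition laplacian :: "'a pair_pre_digraph \<Rightarrow> ('a \<Rightarrow> 'b::comm_ring_1) \<Rightarrow> 'a \<Rightarrow> 'b" where
  "laplacian G f v = (\<Sum>w\<in>neighbours G v. f w - f v)"

text \<open>In the notation of the Bakry-Emery calculus, \<open>energy G f = 2 \<Gamma>(f)\<close>.\<close>

definition energy :: "'a pair_pre_digraph \<Rightarrow> ('a \<Rightarrow> real) \<Rightarrow> 'a \<Rightarrow> real" where
  "energy G f v = (\<Sum>w\<in>neighbours G v. (f w - f v)\<^sup>2)"

section \<open>Walk distance and counts of common neighbours\<close>

lemma graph_dist_attained:
  assumes "graph_dist G u v = enat k"
  shows "\<exists>p. pre_digraph.awalk (with_proj G) u p v \<and> length p = k"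
proof -
  let ?L = "(\<lambda>p. enat (length p)) ` {p. pre_digraph.awalk (with_proj G) u p v}"
  have "?L \<noteq> {}"
  proof
    assume "?L = {}"
    then have "graph_dist G u v = \<infinity>"
      unfolding graph_dist_def by (simp add: top_enat_def)
    with assms show False by simp
  qed
  then have "Inf ?L \<in> ?L"
    by (rule wellorder_InfI[OF ex_in_conv[THEN iffD2, THEN someI_ex]])
  then show ?thesis using assms unfolding graph_dist_def by auto
qed

lemma graph_dist_le:
  "pre_digraph.awalk (with_proj G) u p v \<Longrightarrow> graph_dist G u v \<le> enat (length p)"
  unfolding graph_dist_def by (rule INF_lower) simp

context amply_regular_graph
begin

abbreviation N where "N \<equiv> neighbours G"

lemma neighbours_iff: "w \<in> N v \<longleftrightarrow> (v, w) \<in> parcs G"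
  by (simp add: neighbours_def)

lemma neighbours_sym: "w \<in> N v \<longleftrightarrow> v \<in> N w"
  using pair_sym_arcs unfolding neighbours_def symmetric_def by (auto dest: symD)

lemma neighbours_irrefl: "v \<notin> N v"
  using pair_no_loops[of "(v, v)"] by (auto simp: neighbours_def)

lemma neighbours_in_verts: "w \<in> N v \<Longrightarrow> v \<in> pverts G" "w \<in> N v \<Longrightarrow> w \<in> pverts G"
  by (auto simp: neighbours_def dest: in_arcsD1 in_arcsD2)

lemma finite_N [simp]: "finite (N v)"
proof (cases "v \<in> pverts G")
  case False
  then have "N v = {}" using neighbours_in_verts(1) by blast
  then show ?thesis by simp
qed (rule finite_neighbours)

lemma graph_dist_self: "u \<in> pverts G \<Longrightarrow> graph_dist G u u = 0"
  using graph_dist_le[of G u "[]" u] by (simp add: awalk_Nil_iff flip: zero_enat_def)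

lemma graph_dist_step:
  assumes "w \<in> N v" shows "graph_dist G u w \<le> graph_dist G u v + 1"
proof (cases "graph_dist G u v")
  case (enat k)
  then obtain p where p: "awalk u p v" "length p = k"
    using graph_dist_attained[OF enat] by blast
  have "awalk v [(v, w)] w"
    using assms neighbours_in_verts[OF assms] by (simp add: awalk_simps neighbours_iff)
  with p(1) have "awalk u (p @ [(v, w)]) w" by (rule awalk_appendI)
  from graph_dist_le[OF this] p(2) enat show ?thesis by (simp add: one_enat_def)
qed simp

text \<open>Dropping the last arc of a shortest walk gives \<open>w\<close>, and
  \<open>graph_dist_step\<close> excludes a smaller distance. This drives the inductions along
  geodesics.\<close>

lemma graph_dist_pred:
  assumes "graph_dist G u v = enat (Suc k)"
  obtains w where "v \<in> N w" "graph_dist G u w = enat k"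
proof -
  obtain p where p: "awalk u p v" "length p = Suc k"
    using graph_dist_attained[OF assms] by blast
  then obtain q e where q: "p = q @ [e]" by (metis length_Suc_conv_rev)
  with p have a: "awalk u q (fst e)" "e \<in> parcs G" "snd e = v" "length q = k"
    by (auto simp: awalk_simps)
  then have v: "v \<in> N (fst e)" by (auto simp: neighbours_iff)
  have "graph_dist G u (fst e) \<le> enat k" using graph_dist_le[OF a(1)] a(4) by simp
  moreover have "enat (Suc k) \<le> graph_dist G u (fst e) + 1"
    using graph_dist_step[OF v, of u] assms by simp
  ultimately have "graph_dist G u (fst e) = enat k"
    by (cases "graph_dist G u (fst e)") (auto simp: one_enat_def)
  with v show thesis by (rule that)
qed

lemma graph_dist_eq_0: "graph_dist G u v = 0 \<Longrightarrow> u = v"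
  using graph_dist_attained[of G u v 0] by (auto simp: zero_enat_def awalk_Nil_iff)

lemma graph_dist_eq_1: "graph_dist G u v = 1 \<Longrightarrow> v \<in> N u"
  using graph_dist_pred[of u v 0] graph_dist_eq_0 by (metis One_nat_def one_enat_def zero_enat_def)

lemma graph_dist_two:
  assumes "v \<in> N w" "w \<in> N u" "v \<noteq> u" "v \<notin> N u"
  shows "graph_dist G u v = 2"
proof -
  have u: "u \<in> pverts G" using neighbours_in_verts assms(2) by blast
  have "graph_dist G u v \<le> 2"
    using graph_dist_step[OF assms(1), of u] graph_dist_step[OF assms(2), of u] graph_dist_self[OF u]
    by (metis add_right_mono dual_order.trans one_add_one add_0)
  then obtain k where k: "graph_dist G u v = enat k" "k \<le> 2"
    by (cases "graph_dist G u v") (auto simp: numeral_eq_enat)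
  have "k \<noteq> 0" "k \<noteq> 1"
    using k assms graph_dist_eq_0[of u v] graph_dist_eq_1[of u v] by (auto simp: zero_enat_def one_enat_def)
  with k show ?thesis by (auto simp: numeral_eq_enat le_Suc_eq numeral_2_eq_2)
qed

text \<open>\<open>connected\<close> refers to the symmetrised digraph; the arc set is already
  symmetric, so it yields directed walks.\<close>

lemma finite_graph_dist:
  assumes "connected (with_proj G)" "u \<in> pverts G" "v \<in> pverts G"
  obtains k where "graph_dist G u v = enat k"
proof -
  have "strongly_connected (with_proj G)"
    using assms(1) pair_sym_arcs symmetric_connected_imp_strongly_connected by blast
  then obtain p where "awalk u p v"
    using assms by (auto simp: strongly_connected_def reachable_awalk)
  from graph_dist_le[OF this] show thesis using that by (cases "graph_dist G u v") auto
qed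

text \<open>Distinct neighbours of one vertex are at distance one or two, so one of the two
  parameters always applies.\<close>

lemma card_common_neighbours:
  assumes "y \<in> N x" "z \<in> N x" "y \<noteq> z"
  shows "card (N y \<inter> N z) = (if z \<in> N y then \<alpha> else \<beta>)"
proof (cases "z \<in> N y")
  case True
  then show ?thesis using adjacent[of y z] by (simp add: common_neighbours_def neighbours_iff)
next
  case False
  have "graph_dist G y z = 2"
    by (rule graph_dist_two[of _ x]) (use assms False neighbours_sym in auto)
  then have "card (common_neighbours G y z) = \<beta>"
    using assms neighbours_in_verts distance_two by blast
  with False show ?thesis by (simp add: common_neighbours_def)
qed

lemma sum_swap_neighbours:
  assumes "finite A" "finite B"
  shows "(\<Sum>z\<in>A. \<Sum>w\<in>N z \<inter> B. g z w) = (\<Sum>w\<in>B. \<Sum>z\<in>N w \<inter> A. g z w)"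
proof -
  have "N z \<inter> B = {w \<in> B. w \<in> N z}" "N w \<inter> A = {z \<in> A. w \<in> N z}" for z w
    using neighbours_sym by auto
  then show ?thesis using sum.swap_restrict[OF assms, of g "\<lambda>z w. w \<in> N z"] by simp
qed

lemma laplacian_conv: "v \<in> pverts G \<Longrightarrow> laplacian G f v = sum f (N v) - of_nat d * f v"
  by (simp add: laplacian_def sum_subtractf regular)

subsection \<open>Lin-Lu-Yau curvature\<close>

text \<open>Multiplying the bound by \<open>int \<beta> - 1\<close> keeps the whole argument in the
  integers.\<close>

lemma laplacian_drop:
  fixes f :: "'a \<Rightarrow> int"
  assumes "y \<in> N x" "f y = f x + 1"
    and lip: "\<And>v w. w \<in> N v \<Longrightarrow> f w \<le> f v + 1"
    and "\<beta> \<ge> \<alpha>" "\<beta> \<ge> 1"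
  shows "(int \<beta> - 1) * (laplacian G f x - laplacian G f y - 2) \<ge> (int \<beta> - int \<alpha>) * int \<alpha>"
proof -
  define X where "X = N x - {y}"
  define Y where "Y = N y - {x}"
  define C where "C = N x \<inter> N y"
  \<comment> \<open>\<open>m\<close> is the degree in the bipartite graph between \<open>X\<close>
    and \<open>Y\<close>; the - 1 accounts for the deleted vertex \<open>x\<close> or
    \<open>y\<close>, itself a common neighbour.\<close>
  define m where "m z = (if z \<in> C then int \<alpha> - 1 else int \<beta> - 1)" for z
  have x: "x \<in> N y" using assms(1) neighbours_sym by blast
  have V: "x \<in> pverts G" "y \<in> pverts G" using assms(1) neighbours_in_verts by blast+
  have fin: "finite X" "finite Y" "finite C" by (auto simp: X_def Y_def C_def)
  have CX: "C \<subseteq> X" and CY: "C \<subseteq> Y"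
    using neighbours_irrefl by (auto simp: C_def X_def Y_def)
  have cC: "card C = \<alpha>"
    using adjacent[of x y] assms(1) by (simp add: C_def common_neighbours_def neighbours_iff)
  have mX: "int (card (N z \<inter> Y)) = m z" if "z \<in> X" for z
  proof -
    have z: "z \<in> N x" "z \<noteq> y" using that by (auto simp: X_def)
    have "N z \<inter> Y = (N z \<inter> N y) - {x}" by (auto simp: Y_def)
    moreover have "x \<in> N z \<inter> N y" using x z neighbours_sym by auto
    ultimately have "int (card (N z \<inter> Y)) = int (card (N z \<inter> N y)) - 1"
      by (metis card_Suc_Diff1 finite_Int finite_N add_diff_cancel_left' of_nat_Suc)
    also have "card (N z \<inter> N y) = (if z \<in> C then \<alpha> else \<beta>)"
      using card_common_neighbours[of z x y] z assms(1) neighbours_sym[of y z] by (auto simp: C_def)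
    finally show ?thesis by (simp add: m_def)
  qed
  have mY: "int (card (N w \<inter> X)) = m w" if "w \<in> Y" for w
  proof -
    have w: "w \<in> N y" "w \<noteq> x" using that by (auto simp: Y_def)
    have "N w \<inter> X = (N w \<inter> N x) - {y}" by (auto simp: X_def)
    moreover have "y \<in> N w \<inter> N x" using assms(1) w neighbours_sym by auto
    ultimately have "int (card (N w \<inter> X)) = int (card (N w \<inter> N x)) - 1"
      by (metis card_Suc_Diff1 finite_Int finite_N add_diff_cancel_left' of_nat_Suc)
    also have "card (N w \<inter> N x) = (if w \<in> C then \<alpha> else \<beta>)"
      using card_common_neighbours[of w y x] w x neighbours_sym[of x w] by (auto simp: C_def)
    finally show ?thesis by (simp add: m_def)
  qed
  \<comment> \<open>The correction involves \<open>C\<close> only. As \<open>C\<close> lies in both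
    \<open>X\<close> and \<open>Y\<close>, it cancels when the two weighted sums of \<open>f\<close>
    are subtracted.\<close>
  have msum: "(\<Sum>z\<in>A. m z * g z) = (int \<beta> - 1) * sum g A - (int \<beta> - int \<alpha>) * sum g C"
    if "finite A" "C \<subseteq> A" for A and g :: "'a \<Rightarrow> int"
  proof -
    have "(\<Sum>z\<in>A. m z * g z) = (\<Sum>z\<in>A. (int \<beta> - 1) * g z - (if z \<in> C then (int \<beta> - int \<alpha>) * g z else 0))"
      by (rule sum.cong) (auto simp: m_def algebra_simps)
    also have "\<dots> = (int \<beta> - 1) * sum g A - (\<Sum>z\<in>A \<inter> C. (int \<beta> - int \<alpha>) * g z)"
      by (simp add: sum_subtractf sum_distrib_left sum.inter_restrict[OF that(1)])
    also have "A \<inter> C = C" using that(2) by blast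
    finally show ?thesis by (simp add: sum_distrib_left)
  qed
  have "(\<Sum>w\<in>Y. m w * f w) - (\<Sum>z\<in>X. m z * f z)
      = (\<Sum>w\<in>Y. \<Sum>z\<in>N w \<inter> X. f w) - (\<Sum>z\<in>X. \<Sum>w\<in>N z \<inter> Y. f z)"
    using mX mY by simp
  also have "\<dots> = (\<Sum>z\<in>X. \<Sum>w\<in>N z \<inter> Y. f w) - (\<Sum>z\<in>X. \<Sum>w\<in>N z \<inter> Y. f z)"
    by (simp add: sum_swap_neighbours[OF fin(1,2)])
  also have "\<dots> = (\<Sum>z\<in>X. \<Sum>w\<in>N z \<inter> Y. f w - f z)"
    by (simp only: sum_subtractf)
  also have "\<dots> \<le> (\<Sum>z\<in>X. \<Sum>w\<in>N z \<inter> Y. 1)"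
    by (intro sum_mono) (use lip in \<open>auto simp: algebra_simps\<close>)
  also have "\<dots> = (\<Sum>z\<in>X. m z * 1)" using mX by simp
  finally have "(int \<beta> - 1) * (sum f Y - sum f X) \<le> (int \<beta> - 1) * int (card X) - (int \<beta> - int \<alpha>) * int \<alpha>"
    unfolding msum[OF fin(1) CX] msum[OF fin(2) CY] by (simp add: cC algebra_simps)
  moreover have "int (card X) = int d - 1"
    using regular[OF V(1)] assms(1) unfolding X_def
    by (metis card_Suc_Diff1 finite_N add_diff_cancel_left' of_nat_Suc)
  moreover have "laplacian G f x = sum f X + f y - int d * f x"
    using laplacian_conv[OF V(1), of f] assms(1) by (simp add: X_def sum_diff1)
  moreover have "laplacian G f y = sum f Y + f x - int d * f y"
    using laplacian_conv[OF V(2), of f] x by (simp add: Y_def sum_diff1)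
  ultimately have "laplacian G f x - laplacian G f y - 2 = (int d - 1) - (sum f Y - sum f X)"
      "(int \<beta> - int \<alpha>) * int \<alpha> \<le> (int \<beta> - 1) * (int d - 1) - (int \<beta> - 1) * (sum f Y - sum f X)"
    using assms(2) by (simp_all add: distrib_left)
  then show ?thesis by (simp only: right_diff_distrib)
qed

text \<open>Along a geodesic the Laplacian of the distance from \<open>u\<close> starts at no more
  than \<open>d\<close>, loses at least \<open>2 + m\<close> per step and never falls below
  \<open>- d\<close>.\<close>

lemma diameter_bound_transport:
  assumes conn: "connected (with_proj G)"
    and "\<beta> \<ge> \<alpha>" "\<beta> \<ge> 2" "u \<in> pverts G" "graph_dist G u v = enat D"
  shows "real D * (2 + real_of_int \<lceil>(real \<beta> - real \<alpha>) / (real \<beta> - 1) * real \<alpha>\<rceil>) \<le> 2 * real d"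
proof -
  define m where "m = \<lceil>(real \<beta> - real \<alpha>) / (real \<beta> - 1) * real \<alpha>\<rceil>"
  \<comment> \<open>\<open>the_enat\<close> is harmless: connectedness makes all distances between
    vertices finite.\<close>
  define f where "f w = int (the_enat (graph_dist G u w))" for w
  have f: "graph_dist G u w = enat k \<Longrightarrow> f w = int k" for w k by (simp add: f_def)
  have lip: "f w \<le> f v + 1" if w: "w \<in> N v" for v w
  proof -
    obtain k l where "graph_dist G u v = enat k" "graph_dist G u w = enat l"
      using finite_graph_dist[OF conn assms(4)] neighbours_in_verts[OF w] by metis
    with graph_dist_step[OF w, of u] show ?thesis by (simp add: f one_enat_def)
  qed
  have b: "\<bar>laplacian G f w\<bar> \<le> int d" if "w \<in> pverts G" for w
  proof -
    have "\<bar>f p - f w\<bar> \<le> 1" if "p \<in> N w" for p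
      using lip[OF that] lip[OF that[unfolded neighbours_sym[of p w]]] by linarith
    then have "\<bar>laplacian G f w\<bar> \<le> (\<Sum>p\<in>N w. 1)"
      unfolding laplacian_def by (intro order_trans[OF sum_abs] sum_mono)
    with that show ?thesis by (simp add: regular)
  qed
  have step: "laplacian G f y \<le> laplacian G f x - 2 - m" if "y \<in> N x" "f y = f x + 1" for x y
  proof -
    have "(int \<beta> - int \<alpha>) * int \<alpha> \<le> (int \<beta> - 1) * (laplacian G f x - laplacian G f y - 2)"
      using laplacian_drop[OF that lip] assms(2,3) by simp
    then have "real_of_int ((int \<beta> - int \<alpha>) * int \<alpha>)
        \<le> real_of_int ((int \<beta> - 1) * (laplacian G f x - laplacian G f y - 2))"
      by (simp only: of_int_le_iff)
    then have "(real \<beta> - real \<alpha>) * real \<alpha>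
        \<le> (real \<beta> - 1) * real_of_int (laplacian G f x - laplacian G f y - 2)"
      by simp
    then have "(real \<beta> - real \<alpha>) / (real \<beta> - 1) * real \<alpha>
        \<le> real_of_int (laplacian G f x - laplacian G f y - 2)"
      using assms(3) by (simp add: field_simps)
    then have "m \<le> laplacian G f x - laplacian G f y - 2" unfolding m_def by (simp add: ceiling_le_iff)
    then show ?thesis by simp
  qed
  have "laplacian G f w \<le> int d - int k * (2 + m)" if "graph_dist G u w = enat k" for w k
    using that
  proof (induction k arbitrary: w)
    case 0
    then have "w = u" using graph_dist_eq_0[of u w] by (simp add: zero_enat_def)
    then show ?case using b[OF assms(4)] by simp
  next
    case (Suc k)
    obtain p where p: "w \<in> N p" "graph_dist G u p = enat k" using graph_dist_pred[OF Suc.prems] .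
    have "laplacian G f w \<le> laplacian G f p - 2 - m"
      by (rule step) (use p Suc.prems f in auto)
    with Suc.IH[OF p(2)] show ?case by (simp add: algebra_simps)
  qed
  from this[OF assms(5)] have 1: "laplacian G f v \<le> int d - int D * (2 + m)" .
  have "v \<in> pverts G"
    using graph_dist_attained[OF assms(5)] awalk_last_in_verts by blast
  from b[OF this] 1 have "int D * (2 + m) \<le> 2 * int d" by linarith
  then have "real_of_int (int D * (2 + m)) \<le> real_of_int (2 * int d)" by (simp only: of_int_le_iff)
  then show ?thesis by (simp add: m_def)
qed

subsection \<open>Bakry-Emery curvature\<close>

text \<open>
  The left side of the conclusion is \<open>4 \<Gamma>\<^sub>2(f)(x)\<close>. Normalising \<open>f x = 0\<close> turns it into
  \<open>\<Sum>i\<in>N x. \<Sum>j\<in>N i. (f j - 2 f i)\<^sup>2\<close> up to terms that involve only the values on \<open>N x\<close>.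
\<close>

lemma curvature_dimension_zero:
  fixes f :: "'a \<Rightarrow> real"
  assumes x: "x \<in> pverts G" and f0: "f x = 0"
    and "d > 0" "\<beta> > 0" and large: "\<alpha>\<^sup>2 + 4 * d \<le> 2 * \<beta> * d"
  shows "(\<Sum>i\<in>N x. energy G f i - energy G f x)
      - 2 * (\<Sum>i\<in>N x. f i * (laplacian G f i - laplacian G f x))
    \<ge> (4 + real \<alpha>) * energy G f x"
proof -
  \<comment> \<open>\<open>S\<close> and \<open>B\<close> are the first and second spheres around
    \<open>x\<close>. With \<open>M\<close> the adjacency matrix of the local graph on
    \<open>S\<close>, \<open>P\<close> is the inner product of \<open>f\<close> and
    \<open>M f\<close>, and \<open>H\<close> is the squared norm of \<open>M f\<close>.
    \<open>T\<close> is \<open>d\<close> times the squared norm of \<open>f\<close> minus its mean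
    on \<open>S\<close>.\<close>
  define S where "S = N x"
  define B where "B = (\<Union>i\<in>S. N i) - insert x S"
  define h where "h w = (\<Sum>i\<in>N w \<inter> S. f i)" for w
  define Q where "Q = (\<Sum>i\<in>S. (f i)\<^sup>2)"
  define s where "s = (\<Sum>i\<in>S. f i)"
  define P where "P = (\<Sum>i\<in>S. f i * h i)"
  define H where "H = (\<Sum>i\<in>S. (h i)\<^sup>2)"
  define R where "R = (\<Sum>k\<in>B. (h k)\<^sup>2)"
  define T where "T = real d * Q - s\<^sup>2"
  have fin [simp]: "finite S" "finite B" by (simp_all add: S_def B_def)
  have cS: "card S = d" using regular[OF x] by (simp add: S_def)
  have xS: "x \<notin> S" using neighbours_irrefl by (simp add: S_def)
  have xN: "x \<in> N i" if "i \<in> S" for i using that neighbours_sym by (auto simp: S_def)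
  have SV: "i \<in> pverts G" if "i \<in> S" for i using that neighbours_in_verts by (auto simp: S_def)
  have cNS: "card (N i \<inter> S) = \<alpha>" if "i \<in> S" for i
    using that adjacent[of x i] by (simp add: S_def common_neighbours_def neighbours_iff Int_commute)
  have split: "N i = insert x ((N i \<inter> S) \<union> (N i \<inter> B))" if "i \<in> S" for i
    using that xN by (auto simp: B_def)
  have split_sum: "(\<Sum>j\<in>N i. g j) = g x + (\<Sum>j\<in>N i \<inter> S. g j) + (\<Sum>j\<in>N i \<inter> B. g j)"
    if "i \<in> S" for i and g :: "'a \<Rightarrow> real"
  proof -
    have "x \<notin> (N i \<inter> S) \<union> (N i \<inter> B)" "(N i \<inter> S) \<inter> (N i \<inter> B) = {}"
      using xS by (auto simp: B_def)
    then show ?thesis by (subst split[OF that]) (simp add: sum.union_disjoint)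
  qed
  have cNB: "real (card (N i \<inter> B)) = real d - 1 - real \<alpha>" if "i \<in> S" for i
    using split_sum[OF that, of "\<lambda>_. 1"] regular[OF SV[OF that]] cNS[OF that] by simp
  have cBS: "card (N k \<inter> S) = \<beta>" if k: "k \<in> B" for k
  proof -
    obtain i where i: "i \<in> S" "k \<in> N i" "k \<noteq> x" "k \<notin> S" using k by (auto simp: B_def)
    then show ?thesis
      using card_common_neighbours[of k i x] neighbours_sym[of x k] xN by (auto simp: S_def)
  qed
  \<comment> \<open>both sides sum \<open>f i * f j\<close> over all paths \<open>i - w - j\<close> with ends in \<open>N x\<close>\<close>
  have two_paths: "s\<^sup>2 + H + R = real d * Q + real \<beta> * (s\<^sup>2 - Q) - (real \<beta> - real \<alpha>) * P"
  proof -
    have hx: "h x = s" by (simp add: h_def s_def S_def)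
    \<comment> \<open>All neighbours of \<open>S\<close> lie in this set, so restricting the
      midpoint to it loses no common neighbour.\<close>
    have W: "N i \<inter> N j \<inter> insert x (S \<union> B) = N i \<inter> N j" if "i \<in> S" for i j
      using split[OF that] by auto
    have "s\<^sup>2 + H + R = (\<Sum>w\<in>insert x (S \<union> B). (h w)\<^sup>2)"
    proof -
      have "x \<notin> S \<union> B" "S \<inter> B = {}" using xS by (auto simp: B_def)
      then show ?thesis by (simp add: sum.union_disjoint H_def R_def hx)
    qed
    also have "\<dots> = (\<Sum>w\<in>insert x (S \<union> B). \<Sum>i\<in>N w \<inter> S. f i * h w)"
      by (simp add: power2_eq_square h_def sum_distrib_right)
    also have "\<dots> = (\<Sum>i\<in>S. \<Sum>w\<in>N i \<inter> insert x (S \<union> B). f i * h w)"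
      by (rule sum_swap_neighbours) auto
    also have "\<dots> = (\<Sum>i\<in>S. f i * (\<Sum>j\<in>S. f j * real (card (N i \<inter> N j))))"
    proof (rule sum.cong[OF refl])
      fix i assume i: "i \<in> S"
      have "(\<Sum>w\<in>N i \<inter> insert x (S \<union> B). h w)
          = (\<Sum>w\<in>N i \<inter> insert x (S \<union> B). \<Sum>j\<in>N w \<inter> S. f j)"
        by (simp add: h_def)
      also have "\<dots> = (\<Sum>j\<in>S. \<Sum>w\<in>N j \<inter> (N i \<inter> insert x (S \<union> B)). f j)"
        by (rule sum_swap_neighbours) auto
      also have "\<dots> = (\<Sum>j\<in>S. f j * real (card (N i \<inter> N j)))"
      proof (rule sum.cong[OF refl])
        fix j
        have "N j \<inter> (N i \<inter> insert x (S \<union> B)) = N i \<inter> N j" using W[OF i, of j] by blast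
        then show "(\<Sum>w\<in>N j \<inter> (N i \<inter> insert x (S \<union> B)). f j) = f j * real (card (N i \<inter> N j))"
          by simp
      qed
      finally show "(\<Sum>w\<in>N i \<inter> insert x (S \<union> B). f i * h w)
          = f i * (\<Sum>j\<in>S. f j * real (card (N i \<inter> N j)))"
        by (simp flip: sum_distrib_left)
    qed
    \<comment> \<open>The diagonal terms \<open>i = j\<close> have weight \<alpha>-independent
      \<open>d\<close>; the others have weight \<beta>, corrected to \<alpha> when \<open>j\<close>
      is adjacent to \<open>i\<close>.\<close>
    also have "\<dots> = (\<Sum>i\<in>S. f i * (real d * f i + real \<beta> * (s - f i) - (real \<beta> - real \<alpha>) * h i))"
    proof (rule sum.cong[OF refl])
      fix i assume i: "i \<in> S"
      have "(\<Sum>j\<in>S. f j * real (card (N i \<inter> N j)))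
          = f i * real d + (\<Sum>j\<in>S - {i}. f j * real (card (N i \<inter> N j)))"
        using i regular[OF SV[OF i]] by (simp add: sum.remove)
      also have "(\<Sum>j\<in>S - {i}. f j * real (card (N i \<inter> N j)))
          = (\<Sum>j\<in>S - {i}. real \<beta> * f j - (if j \<in> N i then (real \<beta> - real \<alpha>) * f j else 0))"
        using i by (intro sum.cong refl)
          (auto simp: card_common_neighbours[of i x] S_def algebra_simps)
      also have "\<dots> = real \<beta> * sum f (S - {i}) - (\<Sum>j\<in>(S - {i}) \<inter> N i. (real \<beta> - real \<alpha>) * f j)"
        by (simp add: sum_subtractf sum_distrib_left sum.inter_restrict)
      also have "sum f (S - {i}) = s - f i" using i by (simp add: s_def sum_diff1)
      also have "(S - {i}) \<inter> N i = N i \<inter> S" using neighbours_irrefl[of i] by auto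
      finally have "(\<Sum>j\<in>S. f j * real (card (N i \<inter> N j)))
          = real d * f i + real \<beta> * (s - f i) - (real \<beta> - real \<alpha>) * h i"
        by (simp add: h_def flip: sum_distrib_left)
      then show "f i * (\<Sum>j\<in>S. f j * real (card (N i \<inter> N j)))
          = f i * (real d * f i + real \<beta> * (s - f i) - (real \<beta> - real \<alpha>) * h i)"
        by (rule arg_cong)
    qed
    also have "\<dots> = (\<Sum>i\<in>S. (real d - real \<beta>) * (f i)\<^sup>2 + real \<beta> * s * f i - (real \<beta> - real \<alpha>) * (f i * h i))"
      by (rule sum.cong) (auto simp: algebra_simps power2_eq_square)
    also have "\<dots> = (real d - real \<beta>) * Q + real \<beta> * s * s - (real \<beta> - real \<alpha>) * P"
      by (simp add: sum.distrib sum_subtractf Q_def s_def P_def flip: sum_distrib_left)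
    finally show ?thesis by (simp add: algebra_simps power2_eq_square)
  qed
  \<comment> \<open>with \<open>M\<close> the adjacency matrix of the local graph, this is \<open>(M - \<alpha>/2)\<^sup>2 \<ge> 0\<close> applied to \<open>f\<close> minus its mean\<close>
  have spectral: "4 * real d * (H - real \<alpha> * P) \<ge> - ((real \<alpha>)\<^sup>2 * T)"
  proof -
    \<comment> \<open>\<open>c\<close> is the mean of \<open>h i - \<alpha> / 2 * f i\<close> over
      \<open>S\<close>, because the local graph is \<alpha>-regular.\<close>
    define c where "c = real \<alpha> * s / (2 * real d)"
    have hs: "(\<Sum>i\<in>S. h i) = real \<alpha> * s"
    proof -
      have "(\<Sum>i\<in>S. h i) = (\<Sum>j\<in>S. \<Sum>i\<in>N j \<inter> S. f j)"
        unfolding h_def by (rule sum_swap_neighbours) auto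
      then show ?thesis by (simp add: cNS s_def flip: sum_distrib_left)
    qed
    have "0 \<le> (\<Sum>i\<in>S. (h i - real \<alpha> / 2 * f i - c)\<^sup>2)" by (simp add: sum_nonneg)
    also have "\<dots> = (\<Sum>i\<in>S. (h i)\<^sup>2 - real \<alpha> * (f i * h i) + (real \<alpha>)\<^sup>2 / 4 * (f i)\<^sup>2
        - 2 * c * h i + c * real \<alpha> * f i + c\<^sup>2)"
      by (rule sum.cong) (auto simp: algebra_simps power2_eq_square)
    also have "\<dots> = H - real \<alpha> * P + (real \<alpha>)\<^sup>2 / 4 * Q - 2 * c * (real \<alpha> * s) + c * real \<alpha> * s + real d * c\<^sup>2"
      by (simp add: sum.distrib sum_subtractf cS hs
          flip: sum_distrib_left sum_divide_distrib H_def P_def Q_def s_def)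
    finally have "0 \<le> 4 * real d * (H - real \<alpha> * P + (real \<alpha>)\<^sup>2 / 4 * Q - 2 * c * (real \<alpha> * s) + c * real \<alpha> * s + real d * c\<^sup>2)"
      by simp
    also have "\<dots> = 4 * real d * (H - real \<alpha> * P) + (real \<alpha>)\<^sup>2 * T"
      using \<open>d > 0\<close> by (simp add: c_def T_def field_simps power2_eq_square)
    finally show ?thesis by simp
  qed
  have Tpos: "T \<ge> 0"
    using sum_squared_le_sum_of_squares[of f S] by (simp add: T_def s_def Q_def cS mult.commute)
  \<comment> \<open>This eliminates the values of \<open>f\<close> on \<open>B\<close>. The factor
    \<beta>, the number of neighbours in \<open>S\<close> of a vertex of \<open>B\<close>, avoids a
    division.\<close>
  have B_part: "(\<Sum>i\<in>S. \<Sum>j\<in>N i \<inter> B. (f j - 2 * f i)\<^sup>2) * real \<beta>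
      \<ge> 4 * real \<beta> * (real d - 1 - real \<alpha>) * Q - 4 * R"
  proof -
    \<comment> \<open>the minimum over \<open>f k\<close> is attained at twice the mean of \<open>f\<close> on \<open>N k \<inter> S\<close>\<close>
    have ge: "(\<Sum>i\<in>N k \<inter> S. (f k - 2 * f i)\<^sup>2) * real \<beta>
        \<ge> 4 * real \<beta> * (\<Sum>i\<in>N k \<inter> S. (f i)\<^sup>2) - 4 * (h k)\<^sup>2" if "k \<in> B" for k
    proof -
      have "(\<Sum>i\<in>N k \<inter> S. (f k - 2 * f i)\<^sup>2)
          = (\<Sum>i\<in>N k \<inter> S. (f k)\<^sup>2 - 4 * f k * f i + 4 * (f i)\<^sup>2)"
        by (rule sum.cong) (auto simp: algebra_simps power2_eq_square)
      also have "\<dots> = real \<beta> * (f k)\<^sup>2 - 4 * f k * h k + 4 * (\<Sum>i\<in>N k \<inter> S. (f i)\<^sup>2)"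
        by (simp add: sum.distrib sum_subtractf h_def cBS[OF that] flip: sum_distrib_left)
      finally have *: "(\<Sum>i\<in>N k \<inter> S. (f k - 2 * f i)\<^sup>2)
          = real \<beta> * (f k)\<^sup>2 - 4 * f k * h k + 4 * (\<Sum>i\<in>N k \<inter> S. (f i)\<^sup>2)" .
      have "(\<Sum>i\<in>N k \<inter> S. (f k - 2 * f i)\<^sup>2) * real \<beta>
          = 4 * real \<beta> * (\<Sum>i\<in>N k \<inter> S. (f i)\<^sup>2) - 4 * (h k)\<^sup>2 + (real \<beta> * f k - 2 * h k)\<^sup>2"
        unfolding * by (simp add: power2_diff power_mult_distrib) (simp add: algebra_simps power2_eq_square)
      then show ?thesis using zero_le_power2[of "real \<beta> * f k - 2 * h k"] by linarith
    qed
    have "4 * real \<beta> * (real d - 1 - real \<alpha>) * Q - 4 * R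
        = 4 * real \<beta> * (\<Sum>i\<in>S. \<Sum>k\<in>N i \<inter> B. (f i)\<^sup>2) - 4 * R"
      by (simp add: cNB Q_def mult.assoc flip: sum_distrib_left)
    also have "\<dots> = 4 * real \<beta> * (\<Sum>k\<in>B. \<Sum>i\<in>N k \<inter> S. (f i)\<^sup>2) - 4 * R"
      by (subst sum_swap_neighbours) auto
    also have "\<dots> = (\<Sum>k\<in>B. 4 * real \<beta> * (\<Sum>i\<in>N k \<inter> S. (f i)\<^sup>2) - 4 * (h k)\<^sup>2)"
      by (simp add: sum_subtractf R_def flip: sum_distrib_left)
    also have "\<dots> \<le> (\<Sum>k\<in>B. (\<Sum>i\<in>N k \<inter> S. (f k - 2 * f i)\<^sup>2) * real \<beta>)"
      by (rule sum_mono) (rule ge)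
    also have "\<dots> = (\<Sum>i\<in>S. \<Sum>k\<in>N i \<inter> B. (f k - 2 * f i)\<^sup>2) * real \<beta>"
      by (subst sum_swap_neighbours[of S B]) (auto simp: sum_distrib_right)
    finally show ?thesis .
  qed
  have S_part: "(\<Sum>i\<in>S. \<Sum>j\<in>N i \<inter> S. (f j - 2 * f i)\<^sup>2) = 5 * real \<alpha> * Q - 4 * P"
  proof -
    have "(\<Sum>i\<in>S. \<Sum>j\<in>N i \<inter> S. (f j - 2 * f i)\<^sup>2)
        = (\<Sum>i\<in>S. (\<Sum>j\<in>N i \<inter> S. (f j)\<^sup>2) - 4 * (f i * h i) + 4 * real \<alpha> * (f i)\<^sup>2)"
    proof (rule sum.cong[OF refl])
      fix i assume i: "i \<in> S"
      have "(\<Sum>j\<in>N i \<inter> S. (f j - 2 * f i)\<^sup>2) = (\<Sum>j\<in>N i \<inter> S. (f j)\<^sup>2 - 4 * f i * f j + 4 * (f i)\<^sup>2)"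
        by (rule sum.cong) (auto simp: algebra_simps power2_eq_square)
      then show "(\<Sum>j\<in>N i \<inter> S. (f j - 2 * f i)\<^sup>2)
          = (\<Sum>j\<in>N i \<inter> S. (f j)\<^sup>2) - 4 * (f i * h i) + 4 * real \<alpha> * (f i)\<^sup>2"
        by (simp add: sum.distrib sum_subtractf h_def cNS[OF i] mult.assoc flip: sum_distrib_left)
    qed
    also have "\<dots> = (\<Sum>i\<in>S. \<Sum>j\<in>N i \<inter> S. (f j)\<^sup>2) - 4 * P + 4 * real \<alpha> * Q"
      by (simp add: sum.distrib sum_subtractf P_def Q_def flip: sum_distrib_left)
    also have "(\<Sum>i\<in>S. \<Sum>j\<in>N i \<inter> S. (f j)\<^sup>2) = real \<alpha> * Q"
      by (subst sum_swap_neighbours) (auto simp: cNS Q_def simp flip: sum_distrib_left)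
    finally show ?thesis by simp
  qed
  define L where "L = (\<Sum>i\<in>N x. energy G f i - energy G f x)
      - 2 * (\<Sum>i\<in>N x. f i * (laplacian G f i - laplacian G f x))"
  define Z where "Z = (\<Sum>i\<in>S. \<Sum>j\<in>N i \<inter> B. (f j - 2 * f i)\<^sup>2)"
  have ex: "energy G f x = Q" by (simp add: energy_def Q_def S_def f0)
  have lx: "laplacian G f x = s" by (simp add: laplacian_def s_def S_def f0)
  have "L = (\<Sum>i\<in>S. (\<Sum>j\<in>N i. (f j - 2 * f i)\<^sup>2) - real d * (f i)\<^sup>2 - Q + 2 * s * f i)"
  proof -
    have "(energy G f i - Q) - 2 * (f i * (laplacian G f i - s))
        = (\<Sum>j\<in>N i. (f j - 2 * f i)\<^sup>2) - real d * (f i)\<^sup>2 - Q + 2 * s * f i" if "i \<in> S" for i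
    proof -
      have "energy G f i - 2 * f i * laplacian G f i = (\<Sum>j\<in>N i. (f j - f i)\<^sup>2 - 2 * f i * (f j - f i))"
        unfolding energy_def laplacian_def sum_distrib_left sum_subtractf[symmetric] ..
      also have "\<dots> = (\<Sum>j\<in>N i. (f j - 2 * f i)\<^sup>2 - (f i)\<^sup>2)"
        by (rule sum.cong) (auto simp: algebra_simps power2_eq_square)
      also have "\<dots> = (\<Sum>j\<in>N i. (f j - 2 * f i)\<^sup>2) - real d * (f i)\<^sup>2"
        by (simp add: sum_subtractf regular[OF SV[OF that]])
      finally show ?thesis by (simp add: algebra_simps)
    qed
    then show ?thesis
      unfolding L_def ex lx S_def[symmetric] sum_distrib_left sum_subtractf[symmetric]
      by (intro sum.cong refl)
  qed
  also have "\<dots> = (\<Sum>i\<in>S. \<Sum>j\<in>N i. (f j - 2 * f i)\<^sup>2) - 2 * T"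
    by (simp add: sum.distrib sum_subtractf cS Q_def s_def T_def power2_eq_square flip: sum_distrib_left)
  \<comment> \<open>The summand \<open>j = x\<close> equals \<open>(2 * f i)\<^sup>2\<close>, which
    gives \<open>4 * Q\<close>.\<close>
  also have "(\<Sum>i\<in>S. \<Sum>j\<in>N i. (f j - 2 * f i)\<^sup>2) = 4 * Q + (5 * real \<alpha> * Q - 4 * P) + Z"
    by (simp add: split_sum sum.distrib f0 S_part Z_def Q_def power_mult_distrib flip: sum_distrib_left)
  finally have L: "L = 4 * Q + (5 * real \<alpha> * Q - 4 * P) + Z - 2 * T" .
  \<comment> \<open>\<open>B_part\<close> removes \<open>Z\<close> and \<open>two_paths\<close>
    removes \<open>R\<close>. What remains of \<open>Q\<close> and \<open>s\<^sup>2\<close> combines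
    into \<open>T\<close>, and \<open>spectral\<close> bounds
    \<open>H - \<alpha> * P\<close>.\<close>
  have "real d * (real \<beta> * (L - (4 + real \<alpha>) * Q))
      \<ge> real d * ((2 * real \<beta> - 4) * T + 4 * (H - real \<alpha> * P))"
  proof (rule mult_left_mono)
    have R: "R = real d * Q + real \<beta> * (s\<^sup>2 - Q) - (real \<beta> - real \<alpha>) * P - s\<^sup>2 - H"
      using two_paths by simp
    have "real \<beta> * (L - (4 + real \<alpha>) * Q)
        = real \<beta> * (4 * real \<alpha> * Q - 4 * P - 2 * T) + Z * real \<beta>"
      unfolding L by (simp add: algebra_simps)
    also have "\<dots> \<ge> real \<beta> * (4 * real \<alpha> * Q - 4 * P - 2 * T)
        + (4 * real \<beta> * (real d - 1 - real \<alpha>) * Q - 4 * R)"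
      using B_part by (simp add: Z_def)
    also have "real \<beta> * (4 * real \<alpha> * Q - 4 * P - 2 * T)
        + (4 * real \<beta> * (real d - 1 - real \<alpha>) * Q - 4 * R)
        = (2 * real \<beta> - 4) * T + 4 * (H - real \<alpha> * P)"
      unfolding R T_def by (simp add: algebra_simps)
    finally show "(2 * real \<beta> - 4) * T + 4 * (H - real \<alpha> * P)
        \<le> real \<beta> * (L - (4 + real \<alpha>) * Q)" .
  qed simp
  also have "real d * ((2 * real \<beta> - 4) * T + 4 * (H - real \<alpha> * P))
      \<ge> (2 * real \<beta> * real d - 4 * real d - (real \<alpha>)\<^sup>2) * T"
    using spectral by (simp add: algebra_simps)
  moreover have "(2 * real \<beta> * real d - 4 * real d - (real \<alpha>)\<^sup>2) * T \<ge> 0"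
  proof (rule mult_nonneg_nonneg[OF _ Tpos])
    have "real (\<alpha>\<^sup>2 + 4 * d) \<le> real (2 * \<beta> * d)" using large by (simp only: of_nat_le_iff)
    then show "0 \<le> 2 * real \<beta> * real d - 4 * real d - (real \<alpha>)\<^sup>2" by simp
  qed
  ultimately have "0 \<le> real d * (real \<beta> * (L - (4 + real \<alpha>) * Q))" by linarith
  then have "0 \<le> L - (4 + real \<alpha>) * Q"
    using assms(3,4) by (simp add: zero_le_mult_iff)
  then show ?thesis by (simp add: L_def ex)
qed

text \<open>Only differences of \<open>f\<close> enter, so \<open>f\<close> may be shifted to vanish
  at \<open>x\<close>.\<close>

lemma curvature_dimension:
  fixes f :: "'a \<Rightarrow> real"
  assumes "x \<in> pverts G" "d > 0" "\<beta> > 0" "\<alpha>\<^sup>2 + 4 * d \<le> 2 * \<beta> * d"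
  shows "(\<Sum>i\<in>N x. energy G f i - energy G f x)
      - 2 * (\<Sum>i\<in>N x. (f i - f x) * (laplacian G f i - laplacian G f x))
    \<ge> (4 + real \<alpha>) * energy G f x"
proof -
  have "energy G (\<lambda>v. f v - f x) = energy G f" "laplacian G (\<lambda>v. f v - f x) = laplacian G f"
    by (auto simp: energy_def laplacian_def fun_eq_iff)
  with curvature_dimension_zero[of x "\<lambda>v. f v - f x"] assms show ?thesis by simp
qed

section \<open>Heat flow and its Bonnet-Myers argument\<close>

lemma laplacian_sq_le:
  fixes f :: "'a \<Rightarrow> real"
  assumes "v \<in> pverts G" shows "(laplacian G f v)\<^sup>2 \<le> real d * energy G f v"
  using sum_squared_le_sum_of_squares[of "\<lambda>w. f w - f v" "N v"] regular[OF assms]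
  by (simp add: laplacian_def energy_def mult.commute)

text \<open>Curvature controls the first-order term, and \<open>laplacian_sq_le\<close> bounds the
  second-order one. The step size keeps the weight left on \<open>energy G f x\<close> nonnegative,
  so that \<open>M\<close> may replace this energy too.\<close>

lemma energy_flow_le:
  fixes f :: "'a \<Rightarrow> real"
  assumes V: "x \<in> pverts G" and cd: "d > 0" "\<beta> > 0" "\<alpha>\<^sup>2 + 4 * d \<le> 2 * \<beta> * d"
    and M: "\<And>v. v \<in> pverts G \<Longrightarrow> energy G f v \<le> M"
    and eps: "0 \<le> e" "e * (real d + 4 + real \<alpha>) \<le> 1"
  shows "energy G (\<lambda>v. f v + e * laplacian G f v) x
    \<le> M * (1 - e * (4 + real \<alpha>) + 4 * (real d)\<^sup>2 * e\<^sup>2)"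
proof -
  let ?L = "laplacian G f"
  have NV: "i \<in> pverts G" if "i \<in> N x" for i using that neighbours_in_verts by blast
  have Lsq: "(?L v)\<^sup>2 \<le> real d * M" if "v \<in> pverts G" for v
    using laplacian_sq_le[OF that, of f] mult_left_mono[OF M[OF that], of "real d"] by simp
  have "energy G ?L x \<le> (\<Sum>i\<in>N x. 4 * (real d * M))"
    unfolding energy_def
  proof (rule sum_mono)
    fix i assume "i \<in> N x"
    have "(?L i - ?L x)\<^sup>2 \<le> 2 * (?L i)\<^sup>2 + 2 * (?L x)\<^sup>2"
      using zero_le_power2[of "?L i + ?L x"] by (simp add: power2_sum power2_diff)
    with Lsq[OF V] Lsq[OF NV[OF \<open>i \<in> N x\<close>]] show "(?L i - ?L x)\<^sup>2 \<le> 4 * (real d * M)" by linarith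
  qed
  then have EL: "energy G ?L x \<le> 4 * (real d)\<^sup>2 * M" using regular[OF V] by (simp add: power2_eq_square)
  have "energy G (\<lambda>v. f v + e * ?L v) x
      = (\<Sum>i\<in>N x. (f i - f x)\<^sup>2 + e * (2 * ((f i - f x) * (?L i - ?L x))) + e\<^sup>2 * (?L i - ?L x)\<^sup>2)"
    unfolding energy_def by (rule sum.cong) (auto simp: algebra_simps power2_eq_square)
  also have "\<dots> = energy G f x + e * (2 * (\<Sum>i\<in>N x. (f i - f x) * (?L i - ?L x))) + e\<^sup>2 * energy G ?L x"
    by (simp add: sum.distrib energy_def sum_distrib_left)
  also have "\<dots> \<le> energy G f x + e * ((\<Sum>i\<in>N x. energy G f i - energy G f x) - (4 + real \<alpha>) * energy G f x)
      + e\<^sup>2 * (4 * (real d)\<^sup>2 * M)"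
    using curvature_dimension[OF V cd, of f] EL eps(1) by (intro add_mono mult_left_mono) auto
  finally have 1: "energy G (\<lambda>v. f v + e * ?L v) x \<le> \<dots>" .
  have "(\<Sum>i\<in>N x. energy G f i) \<le> (\<Sum>i\<in>N x. M)" by (rule sum_mono) (use M NV in auto)
  then have "(\<Sum>i\<in>N x. energy G f i - energy G f x) \<le> real d * M - real d * energy G f x"
    using regular[OF V] by (simp add: sum_subtractf)
  from mult_left_mono[OF this eps(1)]
  have 2: "e * (\<Sum>i\<in>N x. energy G f i - energy G f x) \<le> e * (real d * M - real d * energy G f x)" .
  have 3: "(1 - e * (real d + 4 + real \<alpha>)) * energy G f x \<le> (1 - e * (real d + 4 + real \<alpha>)) * M"
    using eps M[OF V] by (intro mult_left_mono) auto
  from 1 2 3 show ?thesis by (simp add: algebra_simps)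
qed

text \<open>Each squared increment along a geodesic is one term of an energy. This crude bound
  serves to make the supremum in \<open>diameter_bound_Bakry_Emery\<close> finite.\<close>

lemma dist_le_energy:
  fixes f :: "'a \<Rightarrow> real"
  assumes "graph_dist G u v = enat k" "\<And>v. v \<in> pverts G \<Longrightarrow> energy G f v \<le> 1"
  shows "f v - f u \<le> real k"
  using assms(1)
proof (induction k arbitrary: v)
  case 0
  then show ?case using graph_dist_eq_0[of u v] by (simp add: zero_enat_def)
next
  case (Suc k)
  obtain w where w: "v \<in> N w" "graph_dist G u w = enat k" using graph_dist_pred[OF Suc.prems] .
  have "(f v - f w)\<^sup>2 \<le> energy G f w"
    unfolding energy_def by (rule member_le_sum[OF w(1)]) auto
  also have "\<dots> \<le> 1" using assms(2) neighbours_in_verts(1)[OF w(1)] .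
  finally have "f v - f w \<le> 1" by (simp add: abs_square_le_1 abs_le_iff)
  with Suc.IH[OF w(2)] show ?case by simp
qed

text \<open>The largest oscillation \<open>s\<close> is squeezed: the heat flow gives
  \<open>s * K \<le> 2 * sqrt d\<close>, and the rescaled distance function gives
  \<open>D / sqrt d \<le> s\<close>.\<close>

lemma diameter_bound_Bakry_Emery:
  assumes conn: "connected (with_proj G)"
    and cd: "d > 0" "\<beta> > 0" "\<alpha>\<^sup>2 + 4 * d \<le> 2 * \<beta> * d"
    and uv: "u \<in> pverts G" "v \<in> pverts G" "graph_dist G u v = enat D"
  shows "real D * (2 + real \<alpha> / 2) \<le> 2 * real d"
proof -
  define K where "K = 2 + real \<alpha> / 2"
  define F where "F = {f :: 'a \<Rightarrow> real. \<forall>w\<in>pverts G. energy G f w \<le> 1}"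
  define A where "A = (\<lambda>f. f v - f u) ` F"
  define s where "s = Sup A"
  have bdd: "bdd_above A"
    unfolding A_def F_def using dist_le_energy[OF uv(3)] by (intro bdd_aboveI2[of _ _ "real D"]) auto
  have le_s: "f v - f u \<le> s" if "f \<in> F" for f
    unfolding s_def by (rule cSup_upper[OF _ bdd]) (use that in \<open>auto simp: A_def\<close>)
  have zero: "(\<lambda>_. 0) \<in> F" by (simp add: F_def energy_def)
  have s0: "0 \<le> s" using le_s[OF zero] by simp
  \<comment> \<open>\<open>r\<close> is chosen with \<open>r\<^sup>2\<close> at least the contraction factor, so that \<open>(f + e * laplacian G f) / r\<close> stays in \<open>F\<close>\<close>
  have step: "s * (K - 2 * (real d)\<^sup>2 * e) \<le> 2 * sqrt (real d)"
    if e: "0 < e" "e * (real d + 4 + real \<alpha>) \<le> 1" for e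
  proof -
    \<comment> \<open>\<open>r - 1\<close> is half the change of the factor in
      \<open>energy_flow_le\<close>, since 1 + t \<le> (1 + t/2)^2; this replaces a square
      root.\<close>
    define r where "r = 1 - e * K + 2 * (real d)\<^sup>2 * e\<^sup>2"
    have "K < real d + 4 + real \<alpha>" by (simp add: K_def)
    then have "e * K < e * (real d + 4 + real \<alpha>)" using e(1) by (rule mult_strict_left_mono)
    then have "e * K < 1" using e(2) by simp
    then have r0: "r > 0" unfolding r_def by (intro add_pos_nonneg) auto
    have r2: "1 - e * (4 + real \<alpha>) + 4 * (real d)\<^sup>2 * e\<^sup>2 \<le> r\<^sup>2"
    proof -
      have "1 - e * (4 + real \<alpha>) + 4 * (real d)\<^sup>2 * e\<^sup>2 = 1 + 2 * (r - 1)"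
        by (simp add: r_def K_def algebra_simps)
      also have "\<dots> \<le> r\<^sup>2" using zero_le_power2[of "r - 1"] by (simp add: power2_diff)
      finally show ?thesis .
    qed
    have "f v - f u \<le> r * s + 2 * e * sqrt (real d)" if f: "f \<in> F" for f
    proof -
      let ?g = "\<lambda>w. f w + e * laplacian G f w"
      have "energy G (\<lambda>w. ?g w / r) w \<le> 1" if "w \<in> pverts G" for w
      proof -
        have "energy G ?g w \<le> r\<^sup>2"
          using energy_flow_le[OF that cd, of f 1 e] f e r2 by (auto simp: F_def)
        moreover have "energy G (\<lambda>w. ?g w / r) w = energy G ?g w / r\<^sup>2"
          by (simp add: energy_def sum_divide_distrib power_divide flip: diff_divide_distrib)
        ultimately show ?thesis using r0 by simp
      qed
      then have "(\<lambda>w. ?g w / r) \<in> F" by (simp add: F_def)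
      from le_s[OF this] have "(?g v - ?g u) / r \<le> s" by (simp only: diff_divide_distrib)
      then have "?g v - ?g u \<le> r * s" using r0 by (simp only: pos_divide_le_eq mult.commute)
      moreover have "\<bar>laplacian G f w\<bar> \<le> sqrt (real d)" if "w \<in> pverts G" for w
      proof -
        have "energy G f w \<le> 1" using f that by (simp add: F_def)
        then have "real d * energy G f w \<le> real d * 1" by (intro mult_left_mono) auto
        then have "\<bar>laplacian G f w\<bar>\<^sup>2 \<le> real d" using laplacian_sq_le[OF that, of f] by simp
        then show ?thesis by (rule real_le_rsqrt)
      qed
      from this[OF uv(1)] this[OF uv(2)]
      have "e * (laplacian G f u - laplacian G f v) \<le> e * (2 * sqrt (real d))"
        using e by (intro mult_left_mono) auto
      ultimately show ?thesis by (simp add: algebra_simps)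
    qed
    \<comment> \<open>The estimate holds for every \<open>f\<close> in \<open>F\<close> with
      \<open>s\<close> on the right, so it passes to the supremum without a maximiser.\<close>
    then have "s \<le> r * s + 2 * e * sqrt (real d)"
      unfolding s_def A_def using zero by (intro cSUP_least) auto
    then have "e * (s * (K - 2 * (real d)\<^sup>2 * e)) \<le> e * (2 * sqrt (real d))"
      by (simp add: r_def algebra_simps power2_eq_square)
    then show ?thesis using e(1) by simp
  qed
  have "((\<lambda>e. s * (K - 2 * (real d)\<^sup>2 * e)) \<longlongrightarrow> s * (K - 2 * (real d)\<^sup>2 * 0)) (at_right 0)"
    by (intro tendsto_intros)
  moreover have "\<forall>\<^sub>F e in at_right 0. s * (K - 2 * (real d)\<^sup>2 * e) \<le> 2 * sqrt (real d)"
    unfolding eventually_at_right_field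
  proof (intro exI conjI allI impI)
    show "0 < 1 / (real d + 4 + real \<alpha>)" by simp
    fix e :: real assume "0 < e" "e < 1 / (real d + 4 + real \<alpha>)"
    then show "s * (K - 2 * (real d)\<^sup>2 * e) \<le> 2 * sqrt (real d)"
      by (intro step) (auto simp: pos_less_divide_eq)
  qed
  ultimately have sK: "s * K \<le> 2 * sqrt (real d)"
    using tendsto_upperbound[of _ _ "at_right (0::real)"] by fastforce
  \<comment> \<open>After this scaling each of the \<open>d\<close> edges at a vertex contributes at
    most \<open>1 / d\<close>, so \<open>f\<close> lies in \<open>F\<close>.\<close>
  define f where "f w = real (the_enat (graph_dist G u w)) / sqrt (real d)" for w
  have "energy G f w \<le> 1" if "w \<in> pverts G" for w
  proof -
    have "(f p - f w)\<^sup>2 \<le> 1 / real d" if p: "p \<in> N w" for p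
    proof -
      obtain k l where kl: "graph_dist G u w = enat k" "graph_dist G u p = enat l"
        using finite_graph_dist[OF conn uv(1)] neighbours_in_verts[OF p] by metis
      have "l \<le> k + 1" "k \<le> l + 1"
        using graph_dist_step[OF p, of u] graph_dist_step[OF p[unfolded neighbours_sym[of p w]], of u] kl
        by (simp_all add: one_enat_def)
      then have "(real l - real k)\<^sup>2 \<le> 1" by (simp add: abs_square_le_1 abs_le_iff)
      then show ?thesis using cd(1)
        by (simp add: f_def kl power_divide divide_right_mono flip: diff_divide_distrib)
    qed
    then have "energy G f w \<le> (\<Sum>p\<in>N w. 1 / real d)" unfolding energy_def by (rule sum_mono)
    then show ?thesis using regular[OF that] cd(1) by simp
  qed
  then have "f v - f u \<le> s" by (intro le_s) (simp add: F_def)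
  then have "real D / sqrt (real d) \<le> s" using uv graph_dist_self by (simp add: f_def zero_enat_def)
  then have "real D \<le> s * sqrt (real d)" using cd(1) by (simp add: field_simps)
  then have "real D * K \<le> s * sqrt (real d) * K" by (intro mult_right_mono) (auto simp: K_def)
  also have "\<dots> = s * K * sqrt (real d)" by simp
  also have "\<dots> \<le> 2 * sqrt (real d) * sqrt (real d)" using sK by (intro mult_right_mono) auto
  also have "\<dots> = 2 * real d" by (simp add: mult.assoc)
  finally show ?thesis by (simp add: K_def)
qed

section \<open>Degree bound and combination of the two diameter bounds\<close>

text \<open>If \<open>x\<close> is midway between \<open>u\<close> and a vertex \<open>w\<close> at
  distance two, then \<open>N x\<close> contains \<open>u\<close>, \<open>w\<close> and the \<alpha>
  common neighbours of \<open>u\<close> and \<open>x\<close>.\<close>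

lemma degree_ge:
  assumes conn: "connected (with_proj G)" and "\<not> complete_graph G"
  shows "\<alpha> + 2 \<le> d"
proof -
  obtain u v where uv: "u \<in> pverts G" "v \<in> pverts G" "u \<noteq> v" "v \<notin> N u"
    using assms(2) by (auto simp: complete_graph_def neighbours_iff)
  have two: "\<exists>w. graph_dist G u w = 2" if "graph_dist G u v = enat (k + 2)" for k v
    using that
  proof (induction k arbitrary: v)
    case 0
    then show ?case by (auto simp: numeral_eq_enat numeral_2_eq_2)
  next
    case (Suc k)
    then show ?case using graph_dist_pred[of u v "k + 2"] by (metis add_Suc)
  qed
  obtain k where k: "graph_dist G u v = enat k" using finite_graph_dist[OF conn uv(1,2)] .
  have "k \<noteq> 0" "k \<noteq> 1"
    using k uv graph_dist_eq_0[of u v] graph_dist_eq_1[of u v] by (auto simp: zero_enat_def one_enat_def)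
  then have "graph_dist G u v = enat (k - 2 + 2)" using k by simp
  from two[OF this] obtain w where w: "graph_dist G u w = enat (Suc 1)"
    by (auto simp: numeral_eq_enat numeral_2_eq_2)
  then obtain x where x: "w \<in> N x" "graph_dist G u x = 1"
    using graph_dist_pred[OF w] by (metis one_enat_def)
  have xu: "x \<in> N u" using graph_dist_eq_1[OF x(2)] .
  have wu: "w \<notin> N u" "w \<noteq> u"
    using graph_dist_step[of w u u] w graph_dist_self[OF uv(1)] by (auto simp: one_enat_def zero_enat_def)
  have "insert w (insert u (N u \<inter> N x)) \<subseteq> N x" using x xu neighbours_sym[of u x] by auto
  moreover have "card (insert w (insert u (N u \<inter> N x))) = \<alpha> + 2"
    using wu neighbours_irrefl adjacent[of u x] xu
    by (simp add: common_neighbours_def neighbours_iff)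
  moreover have "card (N x) = d" using regular neighbours_in_verts(1)[OF x(1)] .
  ultimately show ?thesis by (metis card_mono finite_N)
qed

end

theorem theorem1p3:
  fixes G :: "'a pair_pre_digraph" and n :: enat and d \<alpha> \<beta> :: nat
  assumes "amply_regular_graph G n d \<alpha> \<beta>"
    and "connected (with_proj G)"
    and "\<not> complete_graph G"
    and "\<not> empty_graph G"
    and "\<beta> \<ge> max 3 \<alpha>"
  shows "diameter G \<le> enat (nat \<lfloor>2 * real d /
    (2 + max (real \<alpha> / 2)
             (real_of_int \<lceil>(real \<beta> - real \<alpha>) / (real \<beta> - 1) * real \<alpha>\<rceil>))\<rfloor>)"
proof -
  interpret amply_regular_graph G n d \<alpha> \<beta> by fact
  define m where "m = max (real \<alpha> / 2) (real_of_int \<lceil>(real \<beta> - real \<alpha>) / (real \<beta> - 1) * real \<alpha>\<rceil>)"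
  have b: "\<beta> \<ge> 3" "\<beta> \<ge> \<alpha>" using assms(5) by auto
  have d: "d \<ge> \<alpha> + 2" using degree_ge[OF assms(2,3)] .
  \<comment> \<open>If \<alpha> \<le> 2, then \<alpha>^2 \<le> 2 d, and \<beta> \<ge> 3 suffices. If
    \<alpha> \<ge> 3, then \<beta> \<ge> \<alpha> and d \<ge> \<alpha> + 2 leave a surplus of at
    least \<alpha>^2 - 8 > 0.\<close>
  have large: "\<alpha>\<^sup>2 + 4 * d \<le> 2 * \<beta> * d"
  proof (cases "\<alpha> \<le> 2")
    case True
    have "\<alpha>\<^sup>2 \<le> 2 * d" using mult_mono[of \<alpha> 2 \<alpha> d] True d by (simp add: power2_eq_square)
    moreover have "6 * d \<le> 2 * \<beta> * d" using b by simp
    ultimately show ?thesis by linarith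
  next
    case False
    then obtain k where k: "\<alpha> = 3 + k" by (metis le_add_diff_inverse not_less_eq_eq numeral_2_eq_2 numeral_3_eq_3)
    obtain j where j: "d = \<alpha> + 2 + j" using d le_Suc_ex by blast
    have "\<alpha>\<^sup>2 + 4 * d \<le> 2 * \<alpha> * d" unfolding j k by (simp add: algebra_simps power2_eq_square)
    also have "\<dots> \<le> 2 * \<beta> * d" using b by simp
    finally show ?thesis .
  qed
  have "graph_dist G u v \<le> enat (nat \<lfloor>2 * real d / (2 + m)\<rfloor>)" if uv: "u \<in> pverts G" "v \<in> pverts G" for u v
  proof -
    obtain D where D: "graph_dist G u v = enat D" using finite_graph_dist[OF assms(2) uv] .
    have "real D * (2 + m) \<le> 2 * real d"
      using diameter_bound_transport[OF assms(2) b(2) _ uv(1) D] b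
        diameter_bound_Bakry_Emery[OF assms(2) _ _ large uv D] d
      by (auto simp: m_def max_def)
    then have "real D \<le> 2 * real d / (2 + m)" by (simp add: m_def pos_le_divide_eq max_def)
    then have "int D \<le> \<lfloor>2 * real d / (2 + m)\<rfloor>" by (simp add: le_floor_iff)
    then show ?thesis using D by simp
  qed
  then show ?thesis unfolding diameter_def m_def by (auto intro!: SUP_least)
qed

end
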